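(* Let $f$ be a comparator network of order $n$ that is a selection network for parameter $k$ ($1\le k\le n$), with input variables $x_1,\dots,x_n$ and output variables $y_1,\dots,y_n$, and let $\phi(f)$ be its half encoding. Suppose exactly $k-1$ of the input variables are set to true, all other variables are undefined, and unit propagation has been performed on $\phi(f)$ (so that $y_1,\dots,y_{k-1}$ are true). If we then set $y_k$ to false, unit propagation sets all the input variables that were undefined to false.
   Context: A comparator $c_{i,j}$ ($i<j$) on $\mathbb N^n$ puts the maximum of the entries at positions $i,j$ into position $i$ and the minimum into position $j$; a comparator network of order $n$ is a finite sequence of comparators applied in order. A sequence $\bar x\in\mathbb N^n$ is top $k$ sorted if $x_1\ge\dots\ge x_k$ and $x_i\ge x_j$ for all $i\le k<j$; a comparator network $f$ of order $n$ is a selection network for $k$ if $f(\bar x)$ is top $k$ sorted for every $\bar x\in\mathbb N^n$. Half encoding: each wire position initially carries the boolean input variable $x_i$; processing the comparators in order, a comparator $c_{i,j}$ whose current variables at positions $i,j$ are $a,b$ introduces fresh variables $c,d$, which become the current variables of positions $i$ and $j$ respectively, together with the clauses $hcomp(a,b,c,d)=(\neg a\vee c)\wedge(\neg b\vee c)\wedge(\neg a\vee\neg b\vee d)$. The output variables $y_1,\dots,y_n$ are the final current variables of positions $1,\dots,n$, and $\phi(f)$ is the conjunction of all these clauses. Each variable is true (1), false (0) or undefined. Unit propagation repeatedly finds a clause in which all literals but one are false and the remaining literal is undefined, and sets that literal to true, until a fixpoint is reached. *)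

theory Defs
  imports Main
begin

text \<open>
  Positions are numbered from 1. A sequence of length \<open>n\<close> is a function on positions of
  which only the values on \<open>{1..n}\<close> matter; a comparator is the pair of its positions.
\<close>

type_synonym comparator = "nat \<times> nat"

definition comparator_network :: "nat \<Rightarrow> comparator list \<Rightarrow> bool" where
  "comparator_network n f \<longleftrightarrow> (\<forall>(i, j) \<in> set f. 1 \<le> i \<and> i < j \<and> j \<le> n)"

fun apply_comparator :: "comparator \<Rightarrow> (nat \<Rightarrow> nat) \<Rightarrow> nat \<Rightarrow> nat" where
  "apply_comparator (i, j) x = x(i := max (x i) (x j), j := min (x i) (x j))"

definition apply_network :: "comparator list \<Rightarrow> (nat \<Rightarrow> nat) \<Rightarrow> nat \<Rightarrow> nat" where
  "apply_network f x = fold apply_comparator f x"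

definition top_sorted :: "nat \<Rightarrow> nat \<Rightarrow> (nat \<Rightarrow> nat) \<Rightarrow> bool" where
  "top_sorted n k x \<longleftrightarrow>
     (\<forall>i j. 1 \<le> i \<and> i \<le> j \<and> j \<le> k \<longrightarrow> x i \<ge> x j) \<and>
     (\<forall>i j. 1 \<le> i \<and> i \<le> k \<and> k < j \<and> j \<le> n \<longrightarrow> x i \<ge> x j)"

definition selection_network :: "nat \<Rightarrow> nat \<Rightarrow> comparator list \<Rightarrow> bool" where
  "selection_network n k f \<longleftrightarrow>
     comparator_network n f \<and> (\<forall>x. top_sorted n k (apply_network f x))"

text \<open>
  \<open>Inp i\<close> is the input variable of position \<open>i\<close>; \<open>Upper t\<close> and \<open>Lower t\<close> are the two
  fresh variables (maximum and minimum) introduced by the comparator with index \<open>t\<close>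
  in the network, counted from 0.
\<close>

datatype var = Inp nat | Upper nat | Lower nat

datatype literal = Pos var | Neg var

type_synonym clause = "literal set"

definition hcomp :: "var \<Rightarrow> var \<Rightarrow> var \<Rightarrow> var \<Rightarrow> clause set" where
  "hcomp a b c d = {{Neg a, Pos c}, {Neg b, Pos c}, {Neg a, Neg b, Pos d}}"

text \<open>
  In the next two functions \<open>t\<close> is the index of the first remaining comparator and \<open>cur\<close>
  gives the current variable of each position.
\<close>

fun final_vars :: "nat \<Rightarrow> comparator list \<Rightarrow> (nat \<Rightarrow> var) \<Rightarrow> nat \<Rightarrow> var" where
  "final_vars t [] cur = cur"
| "final_vars t ((i, j) # f) cur = final_vars (Suc t) f (cur(i := Upper t, j := Lower t))"

fun network_clauses :: "nat \<Rightarrow> comparator list \<Rightarrow> (nat \<Rightarrow> var) \<Rightarrow> clause set" where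
  "network_clauses t [] cur = {}"
| "network_clauses t ((i, j) # f) cur =
     hcomp (cur i) (cur j) (Upper t) (Lower t) \<union>
     network_clauses (Suc t) f (cur(i := Upper t, j := Lower t))"

definition output_var :: "comparator list \<Rightarrow> nat \<Rightarrow> var" where
  "output_var f = final_vars 0 f Inp"

definition half_encoding :: "comparator list \<Rightarrow> clause set" where
  "half_encoding f = network_clauses 0 f Inp"

type_synonym assignment = "var \<Rightarrow> bool option"

fun lit_value :: "assignment \<Rightarrow> literal \<Rightarrow> bool option" where
  "lit_value \<rho> (Pos v) = \<rho> v"
| "lit_value \<rho> (Neg v) = map_option Not (\<rho> v)"

fun make_true :: "literal \<Rightarrow> assignment \<Rightarrow> assignment" where
  "make_true (Pos v) \<rho> = \<rho>(v := Some True)"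
| "make_true (Neg v) \<rho> = \<rho>(v := Some False)"

inductive up_step :: "clause set \<Rightarrow> assignment \<Rightarrow> assignment \<Rightarrow> bool" for F where
  "\<lbrakk>C \<in> F; l \<in> C; lit_value \<rho> l = None; \<forall>l' \<in> C - {l}. lit_value \<rho> l' = Some False\<rbrakk>
     \<Longrightarrow> up_step F \<rho> (make_true l \<rho>)"

text \<open>
  The order of the propagation steps is left open: the predicate relates an assignment to
  every fixpoint that some sequence of steps can reach.
\<close>

definition unit_propagation :: "clause set \<Rightarrow> assignment \<Rightarrow> assignment \<Rightarrow> bool" where
  "unit_propagation F \<rho> \<rho>' \<longleftrightarrow> (up_step F)\<^sup>*\<^sup>* \<rho> \<rho>' \<and> \<not> (\<exists>\<rho>''. up_step F \<rho>' \<rho>'')"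

text \<open>A fixpoint is always reached, so quantifying over all of them is never vacuous.\<close>

lemma finite_network_clauses:
  "finite (network_clauses t f cur)" "C \<in> network_clauses t f cur \<Longrightarrow> finite C"
  by (induction t f cur rule: network_clauses.induct) (auto simp: hcomp_def)

lemma unit_propagation_exists: "\<exists>\<rho>'. unit_propagation (half_encoding f) \<rho> \<rho>'"
proof -
  define L where "L = \<Union> (half_encoding f)"
  have fin: "finite L"
    using finite_network_clauses by (auto simp: L_def half_encoding_def)
  have dec: "card {l \<in> L. lit_value \<rho>2 l = None} < card {l \<in> L. lit_value \<rho>1 l = None}"
    if "up_step (half_encoding f) \<rho>1 \<rho>2" for \<rho>1 \<rho>2
    using that
  proof cases
    case (1 C l)
    have "lit_value \<rho>1 l' = None" if "lit_value \<rho>2 l' = None" for l'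
      using that 1(1) by (cases l; cases l') (auto split: if_splits)
    then have sub: "{l' \<in> L. lit_value \<rho>2 l' = None} \<subseteq> {l' \<in> L. lit_value \<rho>1 l' = None}"
      by blast
    have "lit_value \<rho>2 l \<noteq> None"
      using 1(1) by (cases l) auto
    then have "l \<notin> {l' \<in> L. lit_value \<rho>2 l' = None}" by simp
    moreover have "l \<in> {l' \<in> L. lit_value \<rho>1 l' = None}"
      using 1(2-4) unfolding L_def by blast
    ultimately have "{l' \<in> L. lit_value \<rho>2 l' = None} \<subset> {l' \<in> L. lit_value \<rho>1 l' = None}"
      using sub by (metis psubsetI)
    with fin show ?thesis by (simp add: psubset_card_mono)
  qed
  show ?thesis
  proof (induction "card {l \<in> L. lit_value \<rho> l = None}" arbitrary: \<rho> rule: less_induct)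
    case less
    show ?case
    proof (cases "\<exists>\<rho>2. up_step (half_encoding f) \<rho> \<rho>2")
      case True
      then obtain \<rho>2 where step: "up_step (half_encoding f) \<rho> \<rho>2" by blast
      from less[OF dec[OF step]] obtain \<rho>' where "unit_propagation (half_encoding f) \<rho>2 \<rho>'"
        by blast
      with step show ?thesis
        unfolding unit_propagation_def by (meson converse_rtranclp_into_rtranclp)
    next
      case False
      then show ?thesis unfolding unit_propagation_def by blast
    qed
  qed
qed

end

theory Submission
  imports Defs
begin

text \<open>
  Evaluating the network on the indicator function of \<open>T\<close> yields a model of the half encoding
  in which \<open>y\<^sub>k\<close> is false, so propagation never runs into a conflict. For an input \<open>i\<close>
  outside \<open>T\<close>, the runs on \<open>T\<close> and on \<open>T \<union> {i}\<close> differ exactly along one path from \<open>x\<^sub>i\<close> to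
  an output, and selection forces that output to be \<open>y\<^sub>k\<close>. Falsity of \<open>y\<^sub>k\<close> propagates
  backwards along this path: through an upper output unconditionally, and through a lower
  output because there the other comparator input is true.
\<close>

subsection \<open>Networks on 0-1 sequences\<close>

lemma apply_network_Cons: "apply_network (c # f) s = apply_network f (apply_comparator c s)"
  by (simp add: apply_network_def)

lemma apply_comparator_le:
  assumes "\<And>q. s q \<le> b"
  shows "apply_comparator c s q \<le> b"
  using assms by (cases c) (auto simp: max_def min_def)

lemma apply_network_le:
  assumes "\<And>q. s q \<le> b"
  shows "apply_network f s q \<le> b"
  using assms unfolding apply_network_def
  by (induction f arbitrary: s) (auto simp: apply_comparator_le simp del: apply_comparator.simps)

lemma sum_apply_comparator:
  assumes "i \<noteq> j" and "finite A" and "i \<in> A" and "j \<in> A"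
  shows "sum (apply_comparator (i, j) s) A = sum s A"
proof -
  have A: "A = insert i (insert j (A - {i, j}))" using assms by blast
  have split: "sum g A = g i + g j + sum g (A - {i, j})" for g :: "nat \<Rightarrow> nat"
    by (subst A) (use assms in simp)
  have "sum (apply_comparator (i, j) s) (A - {i, j}) = sum s (A - {i, j})"
    by (intro sum.cong) auto
  then show ?thesis using \<open>i \<noteq> j\<close> by (simp add: split max_def min_def)
qed

text \<open>A maximum and a minimum add up to the same sum as the two original values. On 0-1
  sequences this makes the number of ones an invariant of the network.\<close>

lemma sum_apply_network:
  assumes "comparator_network n f"
  shows "sum (apply_network f s) {1..n} = sum s {1..n}"
  using assms unfolding apply_network_def
proof (induction f arbitrary: s)
  case (Cons c f)
  obtain i j where c: "c = (i, j)" by force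
  with Cons.prems have "sum (apply_comparator c s) {1..n} = sum s {1..n}"
    unfolding c by (intro sum_apply_comparator) (auto simp: comparator_network_def)
  with Cons show ?case by (simp add: comparator_network_def)
qed simp

text \<open>A one at \<open>i\<close> forces ones at all of \<open>1..i\<close>; a zero at
  \<open>i\<close> forces zeros from \<open>i\<close> up to \<open>n\<close>, which leaves room for
  at most \<open>i - 1\<close> ones.\<close>

lemma top_sorted_01_iff:
  assumes "top_sorted n k x" and "\<And>q. x q \<le> 1" and "k \<le> n" and "i \<in> {1..k}"
  shows "x i = 1 \<longleftrightarrow> i \<le> sum x {1..n}"
proof
  assume 1: "x i = 1"
  have "i = sum (\<lambda>_. 1) {1..i}" by simp
  also have "\<dots> \<le> sum x {1..i}"
    using assms 1 by (intro sum_mono) (force simp: top_sorted_def)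
  also have "\<dots> \<le> sum x {1..n}"
    using assms by (intro sum_mono2) auto
  finally show "i \<le> sum x {1..n}" .
next
  assume le: "i \<le> sum x {1..n}"
  show "x i = 1"
  proof (rule ccontr)
    assume "x i \<noteq> 1"
    then have 0: "x i = 0" using assms(2)[of i] by simp
    have zero: "x j = 0" if "j \<in> {1..n} - {1..<i}" for j
    proof (cases "j \<le> k")
      case True
      then have "x i \<ge> x j" using assms that by (auto simp: top_sorted_def)
      with 0 show ?thesis by simp
    next
      case False
      then have "x i \<ge> x j" using assms that by (auto simp: top_sorted_def)
      with 0 show ?thesis by simp
    qed
    have "sum x {1..n} = sum x {1..<i}"
      using assms zero by (intro sum.mono_neutral_right) auto
    also have "\<dots> \<le> sum (\<lambda>_. 1) {1..<i}"
      by (intro sum_mono assms(2))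
    finally show False using le assms(4) by simp linarith
  qed
qed

lemma selection_network_indicator_iff:
  assumes "selection_network n k f" and "T \<subseteq> {1..n}" and "k \<le> n" and "i \<in> {1..k}"
  shows "apply_network f (\<lambda>q. of_bool (q \<in> T)) i = 1 \<longleftrightarrow> i \<le> card T"
proof -
  let ?s = "\<lambda>q. of_bool (q \<in> T) :: nat"
  have "sum ?s {1..n} = card T"
    using assms(2) by (simp add: Int_absorb1)
  then show ?thesis
    using top_sorted_01_iff[of n k "apply_network f ?s" i] apply_network_le[of ?s 1 f]
      sum_apply_network[of n f ?s] assms by (auto simp: selection_network_def)
qed

subsection \<open>Unit propagation below a model\<close>

fun lit_true :: "(var \<Rightarrow> bool) \<Rightarrow> literal \<Rightarrow> bool" where
  "lit_true \<alpha> (Pos v) \<longleftrightarrow> \<alpha> v"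
| "lit_true \<alpha> (Neg v) \<longleftrightarrow> \<not> \<alpha> v"

definition is_model :: "(var \<Rightarrow> bool) \<Rightarrow> clause set \<Rightarrow> bool" where
  "is_model \<alpha> F \<longleftrightarrow> (\<forall>C \<in> F. \<exists>l \<in> C. lit_true \<alpha> l)"

text \<open>A fixpoint of unit propagation without falsified clauses.\<close>

definition up_closed :: "clause set \<Rightarrow> assignment \<Rightarrow> bool" where
  "up_closed F \<rho> \<longleftrightarrow> (\<forall>C \<in> F. \<forall>l \<in> C.
     (\<forall>l' \<in> C - {l}. lit_value \<rho> l' = Some False) \<longrightarrow> lit_value \<rho> l = Some True)"

text \<open>The premise \<open>\<rho> \<subseteq>\<^sub>m Some \<circ> \<alpha>\<close> says that
  the partial assignment agrees with the total one wherever it is defined.\<close>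

lemma lit_value_model:
  assumes "\<rho> \<subseteq>\<^sub>m Some \<circ> \<alpha>" and "lit_value \<rho> l = Some b"
  shows "lit_true \<alpha> l = b"
  using assms by (cases l) (auto simp: map_le_def dom_def)

lemma up_step_map_le:
  assumes "up_step F \<rho> \<rho>'"
  shows "\<rho> \<subseteq>\<^sub>m \<rho>'"
  using assms
proof cases
  case (1 C l)
  then show ?thesis by (cases l) (auto simp: map_le_def)
qed

text \<open>The other literals of the unit clause are false under \<alpha> as well, so the model can
  satisfy this clause only through the propagated literal.\<close>

lemma up_step_model:
  assumes "up_step F \<rho> \<rho>'" and "is_model \<alpha> F" and "\<rho> \<subseteq>\<^sub>m Some \<circ> \<alpha>"
  shows "\<rho>' \<subseteq>\<^sub>m Some \<circ> \<alpha>"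
  using assms(1)
proof cases
  case (1 C l)
  obtain l' where "l' \<in> C" "lit_true \<alpha> l'"
    using assms(2) 1 by (auto simp: is_model_def)
  then have "lit_true \<alpha> l"
    using lit_value_model[OF assms(3)] 1 by (metis DiffI singletonD)
  then show ?thesis
    using assms(3) 1 by (cases l) (auto simp: map_le_def)
qed

text \<open>A step assigns only an undefined variable. Hence the true inputs and the false
  \<open>y_k\<close> survive later propagation.\<close>

lemma unit_propagation_map_le:
  assumes "unit_propagation F \<rho> \<rho>'"
  shows "\<rho> \<subseteq>\<^sub>m \<rho>'"
proof -
  have "(up_step F)\<^sup>*\<^sup>* \<rho> \<rho>'" using assms by (simp add: unit_propagation_def)
  then show ?thesis
    by induction (auto intro: map_le_trans up_step_map_le)
qed

lemma unit_propagation_model: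
  assumes "unit_propagation F \<rho> \<rho>'" and "is_model \<alpha> F" and "\<rho> \<subseteq>\<^sub>m Some \<circ> \<alpha>"
  shows "\<rho>' \<subseteq>\<^sub>m Some \<circ> \<alpha>"
proof -
  have "(up_step F)\<^sup>*\<^sup>* \<rho> \<rho>'" using assms by (simp add: unit_propagation_def)
  then show ?thesis
    by induction (use assms up_step_model in blast)+
qed

text \<open>Being stuck shows only that the last literal of the clause is defined; agreement with a
  model excludes that it is false.\<close>

lemma unit_propagation_up_closed:
  assumes up: "unit_propagation F \<rho> \<rho>'" and model: "is_model \<alpha> F" and le: "\<rho> \<subseteq>\<^sub>m Some \<circ> \<alpha>"
  shows "up_closed F \<rho>'"
  unfolding up_closed_def
proof (intro ballI impI)
  fix C l
  assume C: "C \<in> F" and l: "l \<in> C" and others: "\<forall>l' \<in> C - {l}. lit_value \<rho>' l' = Some False"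
  have le': "\<rho>' \<subseteq>\<^sub>m Some \<circ> \<alpha>" using unit_propagation_model[OF assms] .
  obtain l' where "l' \<in> C" "lit_true \<alpha> l'"
    using model C by (auto simp: is_model_def)
  then have "lit_true \<alpha> l"
    using lit_value_model[OF le'] others by (metis DiffI singletonD)
  moreover have "lit_value \<rho>' l \<noteq> None"
    using up C l others unfolding unit_propagation_def by (metis up_step.intros)
  ultimately show "lit_value \<rho>' l = Some True"
    using lit_value_model[OF le'] by force
qed

lemma up_closed_Un: "up_closed (F \<union> G) \<rho> \<longleftrightarrow> up_closed F \<rho> \<and> up_closed G \<rho>"
  by (auto simp: up_closed_def)

text \<open>One rule for each of the seven literal occurrences in the three clauses.\<close>

lemma up_closed_hcompD:
  assumes "up_closed (hcomp a b c d) \<rho>"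
  shows "\<rho> a = Some True \<Longrightarrow> \<rho> c = Some True"
    and "\<rho> b = Some True \<Longrightarrow> \<rho> c = Some True"
    and "\<rho> a = Some True \<Longrightarrow> \<rho> b = Some True \<Longrightarrow> \<rho> d = Some True"
    and "\<rho> c = Some False \<Longrightarrow> \<rho> a = Some False"
    and "\<rho> c = Some False \<Longrightarrow> \<rho> b = Some False"
    and "\<rho> d = Some False \<Longrightarrow> \<rho> b = Some True \<Longrightarrow> \<rho> a = Some False"
    and "\<rho> d = Some False \<Longrightarrow> \<rho> a = Some True \<Longrightarrow> \<rho> b = Some False"
proof -
  have closed: "lit_value \<rho> l = Some True"
    if "C \<in> hcomp a b c d" "l \<in> C" "\<forall>l' \<in> C. l' \<noteq> l \<longrightarrow> lit_value \<rho> l' = Some False" for C l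
    using assms that unfolding up_closed_def by blast
  have C: "{Neg a, Pos c} \<in> hcomp a b c d" "{Neg b, Pos c} \<in> hcomp a b c d"
    "{Neg a, Neg b, Pos d} \<in> hcomp a b c d"
    by (auto simp: hcomp_def)
  show "\<rho> a = Some True \<Longrightarrow> \<rho> c = Some True"
    using closed[OF C(1), of "Pos c"] by auto
  show "\<rho> b = Some True \<Longrightarrow> \<rho> c = Some True"
    using closed[OF C(2), of "Pos c"] by auto
  show "\<rho> a = Some True \<Longrightarrow> \<rho> b = Some True \<Longrightarrow> \<rho> d = Some True"
    using closed[OF C(3), of "Pos d"] by auto
  show "\<rho> c = Some False \<Longrightarrow> \<rho> a = Some False"
    using closed[OF C(1), of "Neg a"] by auto
  show "\<rho> c = Some False \<Longrightarrow> \<rho> b = Some False"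
    using closed[OF C(2), of "Neg b"] by auto
  show "\<rho> d = Some False \<Longrightarrow> \<rho> b = Some True \<Longrightarrow> \<rho> a = Some False"
    using closed[OF C(3), of "Neg a"] by auto
  show "\<rho> d = Some False \<Longrightarrow> \<rho> a = Some True \<Longrightarrow> \<rho> b = Some False"
    using closed[OF C(3), of "Neg b"] by auto
qed

subsection \<open>The half encoding\<close>

text \<open>Covers every variable that the comparators from index \<open>t\<close> on may introduce;
  freshness means that no current variable lies in it.\<close>

definition introduced_from :: "nat \<Rightarrow> var set" where
  "introduced_from t = Upper ` {t..} \<union> Lower ` {t..}"

text \<open>Fresh variables take the maximum and minimum computed by their comparator, with positive
  read as true. Agreement with \<beta> on older variables is what lets the induction satisfy the
  clauses of the first comparator.\<close>

lemma network_clauses_model: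
  assumes "\<And>q. cur q \<notin> introduced_from t" and "\<And>q. \<beta> (cur q) \<longleftrightarrow> s q > 0"
  shows "\<exists>\<alpha>. is_model \<alpha> (network_clauses t f cur) \<and>
    (\<forall>v. v \<notin> introduced_from t \<longrightarrow> \<alpha> v = \<beta> v) \<and>
    (\<forall>q. \<alpha> (final_vars t f cur q) \<longleftrightarrow> apply_network f s q > 0)"
  using assms
proof (induction t f cur arbitrary: \<beta> s rule: network_clauses.induct)
  case (1 t cur)
  then show ?case by (intro exI[of _ \<beta>]) (simp add: is_model_def apply_network_def)
next
  case (2 t i j f cur)
  let ?cur = "cur(i := Upper t, j := Lower t)"
  let ?s = "apply_comparator (i, j) s"
  let ?\<beta> = "\<beta>(Upper t := max (s i) (s j) > 0, Lower t := min (s i) (s j) > 0)"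
  have sub: "introduced_from (Suc t) \<subseteq> introduced_from t"
    by (auto simp: introduced_from_def)
  have new: "Upper t \<in> introduced_from t" "Lower t \<in> introduced_from t"
    "Upper t \<notin> introduced_from (Suc t)" "Lower t \<notin> introduced_from (Suc t)"
    by (auto simp: introduced_from_def)
  have old: "cur q \<noteq> Upper t" "cur q \<noteq> Lower t" for q
    using 2(2)[of q] new by metis+
  have "?cur q \<notin> introduced_from (Suc t)" for q
    using 2(2)[of q] sub new by auto
  moreover have "?\<beta> (?cur q) \<longleftrightarrow> ?s q > 0" for q
    using 2(3) old by simp
  ultimately obtain \<alpha> where \<alpha>: "is_model \<alpha> (network_clauses (Suc t) f ?cur)"
      "\<And>v. v \<notin> introduced_from (Suc t) \<Longrightarrow> \<alpha> v = ?\<beta> v"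
      "\<And>q. \<alpha> (final_vars (Suc t) f ?cur q) \<longleftrightarrow> apply_network f ?s q > 0"
    using 2(1)[of ?\<beta> ?s] by blast
  \<comment> \<open>The current variables are older than all the fresh ones, so \<alpha> gives them
    their values under \<beta>.\<close>
  have ab: "\<alpha> (cur q) \<longleftrightarrow> s q > 0" for q
    using \<alpha>(2)[of "cur q"] 2(2)[of q] 2(3)[of q] sub old[of q] by auto
  have cd: "\<alpha> (Upper t) \<longleftrightarrow> max (s i) (s j) > 0" "\<alpha> (Lower t) \<longleftrightarrow> min (s i) (s j) > 0"
    using \<alpha>(2)[of "Upper t"] \<alpha>(2)[of "Lower t"] new by auto
  have "is_model \<alpha> (hcomp (cur i) (cur j) (Upper t) (Lower t))"
    using ab[of i] ab[of j] cd by (auto simp: is_model_def hcomp_def)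
  with \<alpha>(1) have "is_model \<alpha> (network_clauses t ((i, j) # f) cur)"
    by (auto simp: is_model_def)
  moreover have "\<alpha> v = \<beta> v" if "v \<notin> introduced_from t" for v
  proof -
    have "v \<noteq> Upper t" "v \<noteq> Lower t" using that new by blast+
    with \<alpha>(2)[of v] that sub show ?thesis by auto
  qed
  ultimately show ?case
    using \<alpha>(3) by (intro exI[of _ \<alpha>]) (simp add: apply_network_def)
qed

section \<open>Propagation through the network: true forwards, false backwards\<close>

lemma up_closed_comparator_true:
  assumes "up_closed (hcomp (cur i) (cur j) c d) \<rho>" and "i \<noteq> j"
    and "\<And>q. s q > 0 \<Longrightarrow> \<rho> (cur q) = Some True"
    and "apply_comparator (i, j) s q > 0"
  shows "\<rho> ((cur(i := c, j := d)) q) = Some True"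
  using up_closed_hcompD(1-3)[OF assms(1)] assms(2-)
  by (auto split: if_splits simp: max_def)

text \<open>The premise on \<open>s\<close> goes one way only, since wires carrying zero may be
  undefined. Ones still move forward: one true input yields the upper output, two yield the lower
  one.\<close>

lemma up_closed_network_true:
  assumes "up_closed (network_clauses t f cur) \<rho>" and "comparator_network n f"
    and "\<And>q. s q > 0 \<Longrightarrow> \<rho> (cur q) = Some True"
    and "apply_network f s q > 0"
  shows "\<rho> (final_vars t f cur q) = Some True"
  using assms
proof (induction t f cur arbitrary: s rule: network_clauses.induct)
  case (1 t cur)
  then show ?case by (simp add: apply_network_def)
next
  case (2 t i j f cur)
  have ij: "i \<noteq> j" and net: "comparator_network n f"
    using 2(3) by (auto simp: comparator_network_def)
  have up: "up_closed (hcomp (cur i) (cur j) (Upper t) (Lower t)) \<rho>"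
    "up_closed (network_clauses (Suc t) f (cur(i := Upper t, j := Lower t))) \<rho>"
    using 2(2) by (simp_all add: up_closed_Un)
  have "apply_network f (apply_comparator (i, j) s) q > 0"
    using 2(5) by (simp only: apply_network_Cons)
  with 2(1)[OF up(2) net, of "apply_comparator (i, j) s"] up_closed_comparator_true[OF up(1) ij 2(4)]
  show ?case unfolding final_vars.simps by blast
qed

text \<open>The runs on \<open>s\<close> and \<open>s(p := 1)\<close> differ only at
  \<open>p\<close>. The induction follows this single difference through the comparators until it
  arrives at \<open>k\<close>, and falsity returns along the same path.\<close>

lemma up_closed_network_false:
  assumes "up_closed (network_clauses t f cur) \<rho>" and "comparator_network n f"
    and "\<And>q. s q > 0 \<Longrightarrow> \<rho> (cur q) = Some True"
    and "\<And>q. s q \<le> 1" and "s p = 0"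
    and "apply_network f s k = 0" and "apply_network f (s(p := 1)) k = 1"
    and "\<rho> (final_vars t f cur k) = Some False"
  shows "\<rho> (cur p) = Some False"
  using assms
proof (induction t f cur arbitrary: s p rule: network_clauses.induct)
  \<comment> \<open>With no comparator left, the runs can differ at \<open>k\<close> only if
    \<open>p = k\<close>.\<close>
  case (1 t cur)
  then show ?case by (auto simp: apply_network_def split: if_splits)
next
  case (2 t i j f cur)
  let ?cur = "cur(i := Upper t, j := Lower t)"
  let ?s = "apply_comparator (i, j) s"
  have ij: "i \<noteq> j" and net: "comparator_network n f"
    using 2(3) by (auto simp: comparator_network_def)
  have up: "up_closed (hcomp (cur i) (cur j) (Upper t) (Lower t)) \<rho>"
    "up_closed (network_clauses (Suc t) f ?cur) \<rho>"
    using 2(2) by (simp_all add: up_closed_Un)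
  note hcomp = up_closed_hcompD[OF up(1)]
  have le: "s q \<le> 1" for q using 2(5) by simp
  \<comment> \<open>Here \<open>p'\<close> is where the difference sits after the
    comparator.\<close>
  have IH: "\<rho> (?cur p') = Some False"
    if "?s p' = 0" "apply_comparator (i, j) (s(p := 1)) = ?s(p' := 1)" for p'
  proof (rule 2(1)[OF up(2) net up_closed_comparator_true[OF up(1) ij 2(4)]
        apply_comparator_le[OF le]])
    show "?s p' = 0" by (fact that)
    show "apply_network f ?s k = 0"
      using 2(7) by (simp only: apply_network_Cons)
    show "apply_network f (?s(p' := 1)) k = 1"
      using 2(8) by (simp only: apply_network_Cons that(2))
    show "\<rho> (final_vars (Suc t) f ?cur k) = Some False"
      using 2(9) by simp
  qed
  \<comment> \<open>If the other input is 0, raising \<open>p\<close> changes only the maximum and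
    the path leaves at \<open>i\<close>; if it is 1, only the minimum changes and the path leaves at
    \<open>j\<close>. Other wires are untouched.\<close>
  consider "p = i" "s j = 0" | "p = i" "s j = 1" | "p = j" "s i = 0" | "p = j" "s i = 1"
    | "p \<noteq> i" "p \<noteq> j"
    using le[of i] le[of j] by linarith
  then show ?case
  proof cases
    case 1
    then have "\<rho> (?cur i) = Some False"
      using ij 2(6) by (intro IH) (auto simp: fun_eq_iff)
    with 1 ij hcomp(4) show ?thesis by simp
  next
    case 2
    then have "\<rho> (?cur j) = Some False"
      using ij \<open>s p = 0\<close> by (intro IH) (auto simp: fun_eq_iff)
    \<comment> \<open>The ternary clause has become unit: its lower output is false, and the input
      at \<open>j\<close> is true because \<open>s j = 1\<close>.\<close>
    with 2 ij hcomp(6) "2.prems"(3)[of j] show ?thesis by simp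
  next
    case 3
    then have "\<rho> (?cur i) = Some False"
      using ij 2(6) by (intro IH) (auto simp: fun_eq_iff)
    with 3 ij hcomp(5) show ?thesis by simp
  next
    case 4
    then have "\<rho> (?cur j) = Some False"
      using ij 2(6) by (intro IH) (auto simp: fun_eq_iff)
    with 4 ij hcomp(7) 2(4)[of i] show ?thesis by simp
  next
    case 5
    then have "\<rho> (?cur p) = Some False"
      using ij 2(6) by (intro IH) (auto simp: fun_eq_iff)
    with 5 show ?thesis by simp
  qed
qed

theorem theorem6:
  fixes n k :: nat and f :: "comparator list" and T :: "nat set"
    and \<rho>0 \<rho>1 :: assignment
  assumes "1 \<le> k" and "k \<le> n"
    and "selection_network n k f"
    and "T \<subseteq> {1..n}" and "card T = k - 1"
    and "\<rho>0 = (\<lambda>v. if v \<in> Inp ` T then Some True else None)"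
    and "unit_propagation (half_encoding f) \<rho>0 \<rho>1"
  shows "(\<forall>i \<in> {1..k - 1}. \<rho>1 (output_var f i) = Some True) \<and>
    (\<forall>\<rho>2. unit_propagation (half_encoding f) (\<rho>1(output_var f k := Some False)) \<rho>2 \<longrightarrow>
       (\<forall>i \<in> {1..n} - T. \<rho>2 (Inp i) = Some False))"
proof -
  let ?s = "\<lambda>q. of_bool (q \<in> T) :: nat"
  have net: "comparator_network n f" using assms(3) by (simp add: selection_network_def)
  have out: "apply_network f ?s i = 1 \<longleftrightarrow> i \<le> k - 1" if "i \<in> {1..k}" for i
    using selection_network_indicator_iff[OF assms(3,4,2) that] assms(5) by simp
  have out_k: "apply_network f ?s k = 0"
  proof -
    have "apply_network f ?s k \<le> 1" by (rule apply_network_le) simp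
    moreover have "apply_network f ?s k \<noteq> 1" using out[of k] assms(1) by simp
    ultimately show ?thesis by linarith
  qed
  \<comment> \<open>This evaluation on the indicator of \<open>T\<close> serves as the model for
    both rounds of propagation.\<close>
  obtain \<alpha> where \<alpha>: "is_model \<alpha> (half_encoding f)"
      "\<And>i. \<alpha> (Inp i) \<longleftrightarrow> i \<in> T"
      "\<And>q. \<alpha> (output_var f q) \<longleftrightarrow> apply_network f ?s q > 0"
  proof -
    have inp: "Inp q \<notin> introduced_from 0" for q
      by (auto simp: introduced_from_def)
    have "Inp q \<in> Inp ` T \<longleftrightarrow> ?s q > 0" for q
      by auto
    from network_clauses_model[of Inp 0 "\<lambda>v. v \<in> Inp ` T" ?s f, OF inp this]
    obtain \<alpha> where \<alpha>: "is_model \<alpha> (network_clauses 0 f Inp)"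
      "\<forall>v. v \<notin> introduced_from 0 \<longrightarrow> \<alpha> v = (v \<in> Inp ` T)"
      "\<forall>q. \<alpha> (final_vars 0 f Inp q) \<longleftrightarrow> apply_network f ?s q > 0"
      by (elim exE conjE)
    show ?thesis
    proof (rule that)
      show "is_model \<alpha> (half_encoding f)"
        using \<alpha>(1) by (simp add: half_encoding_def)
      show "\<alpha> (Inp i) \<longleftrightarrow> i \<in> T" for i
        using \<alpha>(2) inp by auto
      show "\<alpha> (output_var f q) \<longleftrightarrow> apply_network f ?s q > 0" for q
        using \<alpha>(3) by (simp add: output_var_def)
    qed
  qed
  have \<rho>0: "\<rho>0 \<subseteq>\<^sub>m Some \<circ> \<alpha>"
    using \<alpha>(2) by (auto simp: map_le_def assms(6) split: if_splits)
  have \<rho>1: "\<rho>1 \<subseteq>\<^sub>m Some \<circ> \<alpha>"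
    using unit_propagation_model[OF assms(7) \<alpha>(1) \<rho>0] .
  have closed1: "up_closed (network_clauses 0 f Inp) \<rho>1"
    using unit_propagation_up_closed[OF assms(7) \<alpha>(1) \<rho>0] by (simp add: half_encoding_def)
  have inp1: "\<rho>1 (Inp q) = Some True" if "q \<in> T" for q
    using unit_propagation_map_le[OF assms(7)] that
    by (force simp: map_le_def dom_def assms(6))
  have "\<rho>1 (output_var f i) = Some True" if "i \<in> {1..k - 1}" for i
    using up_closed_network_true[OF closed1 net, of ?s i] inp1 out[of i] that
    by (auto simp: output_var_def)
  moreover have "\<rho>2 (Inp i) = Some False"
    if up: "unit_propagation (half_encoding f) (\<rho>1(output_var f k := Some False)) \<rho>2"
      and i: "i \<in> {1..n} - T" for \<rho>2 i
  proof -
    \<comment> \<open>Setting \<open>y_k\<close> to false stays below \<alpha>, since output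
      \<open>k\<close> is 0 on \<open>T\<close>.\<close>
    have start: "\<rho>1(output_var f k := Some False) \<subseteq>\<^sub>m Some \<circ> \<alpha>"
      using \<rho>1 \<alpha>(3)[of k] out_k by (auto simp: map_le_def)
    have ext: "\<rho>1(output_var f k := Some False) \<subseteq>\<^sub>m \<rho>2"
      using unit_propagation_map_le[OF up] .
    have closed2: "up_closed (network_clauses 0 f Inp) \<rho>2"
      using unit_propagation_up_closed[OF up \<alpha>(1) start] by (simp add: half_encoding_def)
    have inp2: "\<rho>2 (Inp q) = Some True" if "q \<in> T" for q
    proof -
      \<comment> \<open>On a wire without comparators the output variable is an input variable. The
        values under \<alpha> show that it is not one from \<open>T\<close>, so no true input is
        overwritten.\<close>
      have "Inp q \<noteq> output_var f k" using \<alpha>(2)[of q] \<alpha>(3)[of k] out_k that by auto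
      then show ?thesis using ext inp1[OF that] by (force simp: map_le_def dom_def)
    qed
    have out2: "\<rho>2 (final_vars 0 f Inp k) = Some False"
      using ext by (force simp: map_le_def dom_def output_var_def)
    have "finite T" using assms(4) finite_subset by blast
    \<comment> \<open>Adding \<open>i\<close> yields exactly \<open>k\<close> ones, so output
      \<open>k\<close> flips from 0 to 1 and the path from \<open>i\<close> ends there.\<close>
    then have "card (insert i T) = k" using i assms(1,5) by simp
    moreover have "?s(i := 1) = (\<lambda>q. of_bool (q \<in> insert i T))" by auto
    ultimately have "apply_network f (?s(i := 1)) k = 1"
      using selection_network_indicator_iff[of n k f "insert i T" k] assms(1-4) i by simp
    then show ?thesis
      using up_closed_network_false[OF closed2 net, of ?s i k] inp2 i out_k out2
      by (auto split: if_splits)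
  qed
  ultimately show ?thesis by blast
qed

end
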